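(* Let $A\in\mathbb{R}^{m\times n}$, $\Lambda\in\mathbb{R}^{r\times n}$, $b\in\mathbb{R}^m$, and let $\phi:\mathbb{R}\to[0,\infty)$, not identically zero, satisfy assumption (H). Suppose that either assumption (a) or assumption (b) holds for $(\phi,A,\Lambda)$. Let $\varepsilon>0$ and let $\{x^k\}_{k\ge0}\subset\mathbb{R}^n$ be a sequence generated from an initial point $x^0\in\mathbb{R}^n$ by the iteration $$A^*Ax^{k+1}+2\Lambda^*\,\Psi_\varepsilon'(|y^k|^2)\,y^{k+1}=A^*b,\qquad y^k=\Lambda x^k,\quad k\ge 0.$$ Then $J_\varepsilon(x^k)$ is strictly monotonically decreasing in $k$, unless there exists some $k$ such that $x^k=x^{k+1}$ and $x^k$ satisfies the necessary optimality condition $$A^*Ax+2\Lambda^*\,\Psi_\varepsilon'(|y|^2)\,y=A^*b,\qquad y=\Lambda x. \qquad (\ast)$$ Moreover, the sequence $\{x^k\}$ has at least one cluster point, and every cluster point of $\{x^k\}$ is a solution of $(\ast)$.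
   Context: $|\cdot|_2$ is the Euclidean norm and $^*$ denotes the transpose. Assumption (H) on $\phi$: (i) $\phi$ is even, $\phi(0)=0$, $\phi$ is nondecreasing on $[0,\infty)$ and continuous; (ii) $\phi$ is differentiable on $(0,\infty)$; (iii) $\phi$ is concave on $[0,\infty)$; (iv) there is a neighbourhood of zero in which the function $t\mapsto \phi'(t)/t$ (for $t>0$) is monotone (either increasing or decreasing is admitted). Assumption (a): (i) there is $t_0>0$ such that $\phi(t)$ is constant for $|t|\ge t_0$; and (ii) $\mathrm{rank}(A)=n$. Assumption (b): (i) there is $\gamma>0$ such that $\phi(at)=a^\gamma\phi(t)$ for all $t\in\mathbb{R}$ and all $a>0$; and (ii) $\mathrm{Ker}(A)\cap\mathrm{Ker}(\Lambda)=\{0\}$. For $\varepsilon>0$ and $t\ge0$ define $$\Psi_\varepsilon(t)=\begin{cases}\dfrac{\phi'(\varepsilon)}{2\varepsilon}\,t+\Big(1-\dfrac{\phi'(\varepsilon)\,\varepsilon}{2\phi(\varepsilon)}\Big)\phi(\varepsilon), & 0\le t\le\varepsilon^2,\\[2mm] \phi(\sqrt t), & t\ge\varepsilon^2,\end{cases}$$ so that its derivative is $\Psi_\varepsilon'(t)=\frac{\phi'(\varepsilon)}{2\varepsilon}$ for $0\le t\le\varepsilon^2$ (one-sided at $t=0$) and $\Psi_\varepsilon'(t)=\frac{\phi'(\sqrt t)}{2\sqrt t}$ for $t\ge\varepsilon^2$. The regularized functional is $$J_\varepsilon(x)=\frac12|Ax-b|_2^2+\sum_{i=1}^r\Psi_\varepsilon\big(|(\Lambda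 x)_i|^2\big),\qquad x\in\mathbb{R}^n.$$ For $y,z\in\mathbb{R}^r$, $\Psi_\varepsilon'(|y|^2)\,z$ denotes the vector in $\mathbb{R}^r$ with components $\Psi_\varepsilon'(|y_i|^2)\,z_i$, $i=1,\dots,r$. *)

theory Defs
  imports "HOL-Analysis.Analysis"
begin

text \<open>Differentiability of \<open>\<phi>\<close> is only required away from the origin, so below \<open>deriv \<phi>\<close> is only ever
  evaluated at positive arguments.\<close>

definition assumption_H :: "(real \<Rightarrow> real) \<Rightarrow> bool" where
  "assumption_H \<phi> \<longleftrightarrow>
     (\<forall>t. \<phi> (- t) = \<phi> t) \<and> \<phi> 0 = 0 \<and> mono_on {0..} \<phi> \<and> continuous_on UNIV \<phi> \<and>
     (\<forall>t>0. \<phi> differentiable (at t)) \<and>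
     concave_on {0..} \<phi> \<and>
     (\<exists>\<delta>>0. monotone_on {0<..<\<delta>} (\<le>) (\<le>) (\<lambda>t. deriv \<phi> t / t) \<or>
            monotone_on {0<..<\<delta>} (\<le>) (\<ge>) (\<lambda>t. deriv \<phi> t / t))"

definition assumption_a :: "(real \<Rightarrow> real) \<Rightarrow> real^'n^'m \<Rightarrow> bool" where
  "assumption_a \<phi> A \<longleftrightarrow>
     (\<exists>t0>0. \<exists>c. \<forall>t. \<bar>t\<bar> \<ge> t0 \<longrightarrow> \<phi> t = c) \<and> rank A = CARD('n)"

definition ker :: "real^'n^'m \<Rightarrow> (real^'n) set" where
  "ker A = {x. A *v x = 0}"

definition assumption_b :: "(real \<Rightarrow> real) \<Rightarrow> real^'n^'m \<Rightarrow> real^'n^'r \<Rightarrow> bool" where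
  "assumption_b \<phi> A \<Lambda> \<longleftrightarrow>
     (\<exists>\<gamma>>0. \<forall>t. \<forall>a>0. \<phi> (a * t) = a powr \<gamma> * \<phi> t) \<and> ker A \<inter> ker \<Lambda> = {0}"

text \<open>Only the values for \<open>t \<ge> 0\<close> matter. At \<open>t = \<epsilon>\<^sup>2\<close> the two branches agree when \<open>\<epsilon> > 0\<close> and \<open>\<phi> \<epsilon> \<noteq> 0\<close>;
  the latter holds whenever \<open>\<phi>\<close> satisfies \<open>assumption_H\<close> and is nonnegative and not identically zero.\<close>

definition Psi :: "(real \<Rightarrow> real) \<Rightarrow> real \<Rightarrow> real \<Rightarrow> real" where
  "Psi \<phi> \<epsilon> t =
     (if t \<le> \<epsilon>\<^sup>2
      then deriv \<phi> \<epsilon> / (2 * \<epsilon>) * t + (1 - deriv \<phi> \<epsilon> * \<epsilon> / (2 * \<phi> \<epsilon>)) * \<phi> \<epsilon>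
      else \<phi> (sqrt t))"

text \<open>The derivative relative to the half-line \<open>{0..}\<close>, hence one-sided at \<open>0\<close>. Lemma \<open>dPsi_eq\<close> below
  gives its closed form.\<close>

definition dPsi :: "(real \<Rightarrow> real) \<Rightarrow> real \<Rightarrow> real \<Rightarrow> real" where
  "dPsi \<phi> \<epsilon> t = vector_derivative (Psi \<phi> \<epsilon>) (at t within {0..})"

definition J :: "(real \<Rightarrow> real) \<Rightarrow> real^'n^'m \<Rightarrow> real^'n^'r \<Rightarrow> real^'m \<Rightarrow> real \<Rightarrow> real^'n \<Rightarrow> real" where
  "J \<phi> A \<Lambda> b \<epsilon> x =
     1 / 2 * (norm (A *v x - b))\<^sup>2 + (\<Sum>i\<in>UNIV. Psi \<phi> \<epsilon> (\<bar>(\<Lambda> *v x) $ i\<bar>\<^sup>2))"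

definition dPsi_mult :: "(real \<Rightarrow> real) \<Rightarrow> real \<Rightarrow> real^'r \<Rightarrow> real^'r \<Rightarrow> real^'r" where
  "dPsi_mult \<phi> \<epsilon> y z = (\<chi> i. dPsi \<phi> \<epsilon> (\<bar>y $ i\<bar>\<^sup>2) * z $ i)"

definition optimality_condition ::
    "(real \<Rightarrow> real) \<Rightarrow> real^'n^'m \<Rightarrow> real^'n^'r \<Rightarrow> real^'m \<Rightarrow> real \<Rightarrow> real^'n \<Rightarrow> bool" where
  "optimality_condition \<phi> A \<Lambda> b \<epsilon> x \<longleftrightarrow>
     (transpose A ** A) *v x + 2 *\<^sub>R (transpose \<Lambda> *v dPsi_mult \<phi> \<epsilon> (\<Lambda> *v x) (\<Lambda> *v x))
       = transpose A *v b"

definition iterates ::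
    "(real \<Rightarrow> real) \<Rightarrow> real^'n^'m \<Rightarrow> real^'n^'r \<Rightarrow> real^'m \<Rightarrow> real \<Rightarrow> (nat \<Rightarrow> real^'n) \<Rightarrow> bool" where
  "iterates \<phi> A \<Lambda> b \<epsilon> x \<longleftrightarrow>
     (\<forall>k. (transpose A ** A) *v x (Suc k)
            + 2 *\<^sub>R (transpose \<Lambda> *v dPsi_mult \<phi> \<epsilon> (\<Lambda> *v x k) (\<Lambda> *v x (Suc k)))
          = transpose A *v b)"

definition cluster_point :: "(nat \<Rightarrow> 'a::metric_space) \<Rightarrow> 'a \<Rightarrow> bool" where
  "cluster_point x l \<longleftrightarrow> (\<exists>s::nat \<Rightarrow> nat. strict_mono s \<and> (x \<circ> s) \<longlonglongrightarrow> l)"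

lemma dPsi_eq:
  assumes "\<epsilon> > 0" "\<phi> \<epsilon> \<noteq> 0" and diff: "\<And>s. s > 0 \<Longrightarrow> \<phi> differentiable (at s)" and "t \<ge> 0"
  shows "(Psi \<phi> \<epsilon> has_vector_derivative
            (if t \<le> \<epsilon>\<^sup>2 then deriv \<phi> \<epsilon> / (2 * \<epsilon>) else deriv \<phi> (sqrt t) / (2 * sqrt t)))
         (at t within {0..})" (is "(_ has_vector_derivative ?D) _")
    and "dPsi \<phi> \<epsilon> t =
          (if t \<le> \<epsilon>\<^sup>2 then deriv \<phi> \<epsilon> / (2 * \<epsilon>) else deriv \<phi> (sqrt t) / (2 * sqrt t))"
proof -
  have e2: "\<epsilon>\<^sup>2 > 0" "sqrt (\<epsilon>\<^sup>2) = \<epsilon>" using assms(1) by auto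
  have cont: "deriv \<phi> \<epsilon> / (2 * \<epsilon>) * \<epsilon>\<^sup>2 + (1 - deriv \<phi> \<epsilon> * \<epsilon> / (2 * \<phi> \<epsilon>)) * \<phi> \<epsilon> = \<phi> \<epsilon>"
    using assms(1,2) by (simp add: field_simps power2_eq_square)
  have L: "(Psi \<phi> \<epsilon> has_field_derivative deriv \<phi> \<epsilon> / (2 * \<epsilon>)) (at t within {0..\<epsilon>\<^sup>2})"
    if "t \<le> \<epsilon>\<^sup>2"
  proof (rule has_field_derivative_transform_within[where d = 1])
    show "((\<lambda>t. deriv \<phi> \<epsilon> / (2 * \<epsilon>) * t + (1 - deriv \<phi> \<epsilon> * \<epsilon> / (2 * \<phi> \<epsilon>)) * \<phi> \<epsilon>)
            has_field_derivative deriv \<phi> \<epsilon> / (2 * \<epsilon>)) (at t within {0..\<epsilon>\<^sup>2})"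
      using assms(1) by (auto intro!: derivative_eq_intros)
  qed (use that assms in \<open>auto simp: Psi_def\<close>)
  have R: "(Psi \<phi> \<epsilon> has_field_derivative deriv \<phi> (sqrt t) / (2 * sqrt t)) (at t within {\<epsilon>\<^sup>2..})"
    if t: "t \<ge> \<epsilon>\<^sup>2"
  proof (rule has_field_derivative_transform_within[where d = 1])
    have t0: "t > 0" using t e2 by linarith
    have 1: "(\<phi> has_field_derivative deriv \<phi> (sqrt t)) (at (sqrt t))"
      using diff[of "sqrt t"] t0 by (simp add: DERIV_deriv_iff_real_differentiable)
    have 2: "(sqrt has_field_derivative inverse (sqrt t) / 2) (at t)"
      using DERIV_real_sqrt[OF t0] .
    show "((\<lambda>t. \<phi> (sqrt t)) has_field_derivative deriv \<phi> (sqrt t) / (2 * sqrt t))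
           (at t within {\<epsilon>\<^sup>2..})"
      using DERIV_chain2[OF 1 2] by (simp add: field_simps has_field_derivative_at_within)
    show "\<phi> (sqrt x) = Psi \<phi> \<epsilon> x" if "x \<in> {\<epsilon>\<^sup>2..}" for x
      using that cont e2 by (cases "x = \<epsilon>\<^sup>2") (auto simp: Psi_def)
  qed (use that in auto)
  have "(Psi \<phi> \<epsilon> has_field_derivative ?D) (at t within {0..})"
  proof (rule linorder_cases[of t "\<epsilon>\<^sup>2"])
    assume a: "t < \<epsilon>\<^sup>2"
    have "at t within {0..\<epsilon>\<^sup>2} = at t within {0..}"
      by (rule at_within_nhd[where S = "{..<\<epsilon>\<^sup>2}"]) (use a in auto)
    then show ?thesis using L a by simp
  next
    assume a: "t > \<epsilon>\<^sup>2"
    have "at t within {\<epsilon>\<^sup>2..} = at t within {0..}"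
      by (rule at_within_nhd[where S = "{\<epsilon>\<^sup>2<..}"]) (use a e2(1) in \<open>auto intro: less_imp_le dest: less_trans[OF e2(1)]\<close>)
    then show ?thesis using R a by simp
  next
    assume a: "t = \<epsilon>\<^sup>2"
    have "{0..} = {0..\<epsilon>\<^sup>2} \<union> {\<epsilon>\<^sup>2..}"
      by (auto intro: order.trans[OF zero_le_power2])
    then show ?thesis using L R a e2
      by (auto simp: has_field_derivative_iff Lim_within_Un)
  qed
  then show *: "(Psi \<phi> \<epsilon> has_vector_derivative ?D) (at t within {0..})"
    by (simp add: has_real_derivative_iff_has_vector_derivative)
  have "at t within {0..} \<noteq> bot"
  proof -
    have "at_right t \<le> at t within {0..}" by (rule at_le) (use assms(4) in auto)
    then show ?thesis using trivial_limit_at_right_real[of t] by (metis le_bot)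
  qed
  then show "dPsi \<phi> \<epsilon> t = ?D"
    unfolding dPsi_def using * by (rule vector_derivative_within)
qed

end

theory Submission
  imports Defs
begin

text \<open>Extended affinely to negative arguments, \<open>\<Psi>\<^sub>\<epsilon>\<close> is differentiable and concave on all of \<open>\<real>\<close>, so
  its derivative \<open>w\<close> is nonincreasing and continuous. Testing the iteration with
  \<open>d\<^sub>k = x\<^sub>k\<^sub>+\<^sub>1 - x\<^sub>k\<close> and using that concave functions lie below their tangents gives
  \<open>J(x\<^sub>k) - J(x\<^sub>k\<^sub>+\<^sub>1) \<ge> |A d\<^sub>k|\<^sup>2 / 2 + \<Sum>\<^sub>i w(|(\<Lambda> x\<^sub>k)\<^sub>i|\<^sup>2) |(\<Lambda> d\<^sub>k)\<^sub>i|\<^sup>2\<close>.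
  The iterates are bounded: by injectivity of \<open>A\<close> in case (a), and in case (b) because \<open>\<phi>\<close> is coercive and
  \<open>(A, \<Lambda>)\<close> is injective. On bounded sets \<open>w\<close> is bounded away from zero in case (b), so in both cases the
  right-hand side dominates a multiple of \<open>|d\<^sub>k|\<^sup>2\<close>. Hence \<open>d\<^sub>k \<rightarrow> 0\<close>, and one passes to the limit
  along a convergent subsequence.\<close>

section \<open>Differentiable concave functions on the line\<close>

lemma concave_on_below_tangent:
  fixes f :: "real \<Rightarrow> real"
  assumes "concave_on S f" "c \<in> interior S" "u \<in> S" "(f has_real_derivative d) (at c)"
  shows "f u \<le> f c + d * (u - c)"
proof -
  have "convex_on S (\<lambda>x. - f x)" "connected S"
    using assms(1) concave_on_imp_convex[OF assms(1)] convex_connected by (simp_all add: concave_on_def)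
  moreover have "((\<lambda>x. - f x) has_real_derivative - d) (at c within S)"
    using DERIV_minus[OF assms(4)] by (rule has_field_derivative_at_within)
  ultimately have "- f u - - f c \<ge> - d * (u - c)"
    using assms(2,3) by (intro convex_on_imp_above_tangent)
  then show ?thesis by simp
qed

lemma concave_on_deriv_antimono:
  fixes f :: "real \<Rightarrow> real"
  assumes "concave_on S f" "s \<in> interior S" "t \<in> interior S" "s \<le> t"
    and "(f has_real_derivative d) (at s)" "(f has_real_derivative e) (at t)"
  shows "e \<le> d"
proof (cases "s = t")
  case True
  then show ?thesis using assms DERIV_unique by blast
next
  case False
  \<comment> \<open>Adding the tangent inequalities at \<open>s\<close> and at \<open>t\<close>
    cancels the values of \<open>f\<close>.\<close>
  have "f t \<le> f s + d * (t - s)" "f s \<le> f t + e * (s - t)"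
    using assms interior_subset by (blast intro: concave_on_below_tangent)+
  then have "e * (t - s) \<le> d * (t - s)" by (simp add: algebra_simps)
  then show ?thesis using False assms(4) by simp
qed

text \<open>Serves the passage to the limit in the weights. For \<open>u > s\<close> the chord slope
  from \<open>s\<close> to \<open>u\<close> is at most \<open>w s\<close>. With \<open>u\<close>
  fixed slightly to the right of \<open>t\<close>, this slope is continuous in \<open>s\<close> near
  \<open>t\<close> and close to \<open>w t\<close>, so it bounds \<open>w\<close> from below near
  \<open>t\<close>; chords to the left give the upper bound.\<close>

lemma concave_on_deriv_continuous:
  fixes f w :: "real \<Rightarrow> real"
  assumes "concave_on UNIV f" and D: "\<And>t. (f has_real_derivative w t) (at t)"
  shows "isCont w t"
proof -
  have tan: "f u \<le> f s + w s * (u - s)" for s u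
    using concave_on_below_tangent[OF assms(1) _ _ D] by simp
  have f_cont: "(f \<longlongrightarrow> f t) (at t)"
    using DERIV_isCont[OF D] by (simp add: isCont_def)
  have quot: "((\<lambda>h. (f (t + h) - f t) / h) \<longlongrightarrow> w t) (at 0)"
    using D[of t] by (simp add: DERIV_def)
  have "(w \<longlongrightarrow> w t) (at t)"
  proof (rule order_tendstoI)
    fix a assume "a < w t"
    then obtain r where r: "r > 0" "\<And>h. h \<noteq> 0 \<Longrightarrow> \<bar>h\<bar> < r \<Longrightarrow> a < (f (t + h) - f t) / h"
      using order_tendstoD(1)[OF quot \<open>a < w t\<close>] by (auto simp: eventually_at)
    define u where "u = t + r / 2"
    have "a < (f u - f t) / (u - t)" using r(1) r(2)[of "r / 2"] by (simp add: u_def)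
    moreover have "((\<lambda>s. (f u - f s) / (u - s)) \<longlongrightarrow> (f u - f t) / (u - t)) (at t)"
      using r(1) by (intro tendsto_intros f_cont) (simp add: u_def)
    ultimately have "eventually (\<lambda>s. a < (f u - f s) / (u - s)) (at t)"
      by (rule order_tendstoD(1)[rotated])
    moreover have "eventually (\<lambda>s. s < u) (at t)"
      by (rule order_tendstoD(2)[OF tendsto_ident_at]) (use r(1) in \<open>simp add: u_def\<close>)
    ultimately show "eventually (\<lambda>s. a < w s) (at t)"
    proof eventually_elim
      case (elim s)
      have "(f u - f s) / (u - s) \<le> w s"
        using tan[of u s] elim by (simp add: divide_le_eq)
      then show ?case using elim by simp
    qed
  next
    fix a assume "w t < a"
    then obtain r where r: "r > 0" "\<And>h. h \<noteq> 0 \<Longrightarrow> \<bar>h\<bar> < r \<Longrightarrow> (f (t + h) - f t) / h < a"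
      using order_tendstoD(2)[OF quot \<open>w t < a\<close>] by (auto simp: eventually_at)
    define u where "u = t - r / 2"
    have "(f t - f u) / (t - u) < a" using r(1) r(2)[of "- (r / 2)"] by (simp add: u_def field_simps)
    moreover have "((\<lambda>s. (f s - f u) / (s - u)) \<longlongrightarrow> (f t - f u) / (t - u)) (at t)"
      using r(1) by (intro tendsto_intros f_cont) (simp add: u_def)
    ultimately have "eventually (\<lambda>s. (f s - f u) / (s - u) < a) (at t)"
      by (rule order_tendstoD(2)[rotated])
    moreover have "eventually (\<lambda>s. u < s) (at t)"
      by (rule order_tendstoD(1)[OF tendsto_ident_at]) (use r(1) in \<open>simp add: u_def\<close>)
    ultimately show "eventually (\<lambda>s. w s < a) (at t)"
    proof eventually_elim
      case (elim s)
      have "w s \<le> (f s - f u) / (s - u)"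
        using tan[of u s] elim by (simp add: le_divide_eq algebra_simps)
      then show ?case using elim by simp
    qed
  qed
  then show ?thesis by (simp add: isCont_def)
qed

lemma antimono_deriv_imp_concave_on:
  fixes f w :: "real \<Rightarrow> real"
  assumes "antimono w" "\<And>t. (f has_real_derivative w t) (at t)"
  shows "concave_on UNIV f"
  unfolding concave_on_def
  by (rule convex_on_realI[where f' = "\<lambda>t. - w t"])
     (use assms in \<open>auto intro!: derivative_eq_intros simp: antimono_def\<close>)

text \<open>A decreasing sequence bounded below converges, so its successive differences tend to
  zero, and these dominate \<open>q\<close>.\<close>

lemma decrements_tendsto_0:
  fixes a q :: "nat \<Rightarrow> real"
  assumes "\<And>k. 0 \<le> a k" "\<And>k. 0 \<le> q k" and q: "\<And>k. q k \<le> a k - a (Suc k)"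
  shows "q \<longlonglongrightarrow> 0"
proof -
  have "decseq a"
    using assms(2) q by (intro decseq_SucI) (smt (verit))
  then obtain L where "a \<longlonglongrightarrow> L" using decseq_convergent[of a 0] assms(1) by blast
  then have "(\<lambda>k. a k - a (Suc k)) \<longlonglongrightarrow> L - L"
    by (intro tendsto_diff LIMSEQ_Suc)
  then show ?thesis
    using assms by (intro tendsto_sandwich[of "\<lambda>_. 0" q sequentially "\<lambda>k. a k - a (Suc k)"]) auto
qed

text \<open>Joint injectivity of \<open>A\<close> and \<open>\<Lambda>\<close> thus becomes
  injectivity of one linear map, which in finite dimension yields a bound \<open>c * norm z\<close>
  from below.\<close>

lemma linear_matrix_vector_pair: "linear (\<lambda>z. ((A :: real^'n^'m) *v z, (\<Lambda> :: real^'n^'r) *v z))"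
  by (intro linearI) (auto simp: matrix_vector_right_distrib matrix_vector_mult_scaleR)

section \<open>Iteratively reweighted least squares with a concave penalty\<close>

text \<open>Collects what the descent argument uses of the penalty: \<open>f\<close> stands for
  \<open>Psi \<phi> \<epsilon>\<close> and \<open>w\<close> for its derivative. The derivative is
  two-sided on the whole line, so that every point is interior, including the argument 0. The
  disjuncts of \<open>coercive\<close> correspond to assumptions (a) and (b).\<close>

locale reweighted_least_squares =
  fixes A :: "real^'n^'m" and \<Lambda> :: "real^'n^'r" and b :: "real^'m"
    and f w :: "real \<Rightarrow> real" and x :: "nat \<Rightarrow> real^'n"
  assumes f_deriv: "(f has_real_derivative w t) (at t)"
    and w_antimono: "antimono w"
    and w_nonneg: "0 \<le> w t"
    and f_nonneg: "0 \<le> t \<Longrightarrow> 0 \<le> f t"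
    and iter: "transpose A *v (A *v x (Suc k) - b)
       + 2 *\<^sub>R (transpose \<Lambda> *v (\<chi> i. w (((\<Lambda> *v x k) $ i)\<^sup>2) * (\<Lambda> *v x (Suc k)) $ i)) = 0"
    and coercive: "inj ((*v) A) \<or>
       inj (\<lambda>z. (A *v z, \<Lambda> *v z)) \<and> (\<forall>t. 0 < w t) \<and> (\<forall>C. \<exists>R. \<forall>y. f (y\<^sup>2) \<le> C \<longrightarrow> \<bar>y\<bar> \<le> R)"
begin

definition objective :: "real^'n \<Rightarrow> real" where
  "objective z = 1 / 2 * (norm (A *v z - b))\<^sup>2 + (\<Sum>i\<in>UNIV. f (((\<Lambda> *v z) $ i)\<^sup>2))"

definition decrement :: "nat \<Rightarrow> real" where
  "decrement k = 1 / 2 * (norm (A *v (x (Suc k) - x k)))\<^sup>2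
     + (\<Sum>i\<in>UNIV. w (((\<Lambda> *v x k) $ i)\<^sup>2) * ((\<Lambda> *v (x (Suc k) - x k)) $ i)\<^sup>2)"

lemma f_concave: "concave_on UNIV f"
  using w_antimono f_deriv by (rule antimono_deriv_imp_concave_on)

lemma objective_nonneg: "0 \<le> objective z"
  unfolding objective_def by (intro add_nonneg_nonneg sum_nonneg f_nonneg) auto

lemma decrement_nonneg: "0 \<le> decrement k"
  unfolding decrement_def by (intro add_nonneg_nonneg sum_nonneg mult_nonneg_nonneg w_nonneg) auto

text \<open>Test the iteration with \<open>d = x (Suc k) - x k\<close> and bound the penalty at \<open>x (Suc k)\<close> by its
  tangent at \<open>x k\<close>; per component \<open>2 v (v - u) + u\<^sup>2 - v\<^sup>2 = (v - u)\<^sup>2\<close>.\<close>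

lemma decrement_le: "decrement k \<le> objective (x k) - objective (x (Suc k))"
proof -
  define d where "d = x (Suc k) - x k"
  define u where "u i = (\<Lambda> *v x k) $ i" for i
  define v where "v i = (\<Lambda> *v x (Suc k)) $ i" for i
  define e where "e = A *v x (Suc k) - b"
  have Ld: "(\<Lambda> *v d) $ i = v i - u i" for i
    by (simp add: d_def u_def v_def matrix_vector_mult_diff_distrib)
  have "0 = (transpose A *v e + 2 *\<^sub>R (transpose \<Lambda> *v (\<chi> i. w ((u i)\<^sup>2) * v i))) \<bullet> d"
    using iter[of k] by (simp add: e_def u_def v_def del: transpose_matrix_vector)
  also have "\<dots> = e \<bullet> (A *v d) + 2 * (\<Sum>i\<in>UNIV. w ((u i)\<^sup>2) * v i * (v i - u i))"
    by (simp add: inner_add_left dot_lmul_matrix inner_vec_def[of _ "\<Lambda> *v d"] Ld)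
  finally have test: "e \<bullet> (A *v d) = - (\<Sum>i\<in>UNIV. 2 * (w ((u i)\<^sup>2) * v i * (v i - u i)))"
    by (simp add: sum_distrib_left)
  \<comment> \<open>Expanding the old residual around the new one makes the cross term the inner
    product computed in \<open>test\<close>.\<close>
  have "A *v x k - b = e - A *v d"
    by (simp add: e_def d_def matrix_vector_mult_diff_distrib)
  then have quad: "(norm (A *v x k - b))\<^sup>2 = (norm e)\<^sup>2 - 2 * (e \<bullet> (A *v d)) + (norm (A *v d))\<^sup>2"
    by (simp add: power2_norm_eq_inner inner_diff_left inner_diff_right inner_commute)
  have "f ((v i)\<^sup>2) \<le> f ((u i)\<^sup>2) + w ((u i)\<^sup>2) * ((v i)\<^sup>2 - (u i)\<^sup>2)" for i
    using concave_on_below_tangent[OF f_concave _ _ f_deriv] by simp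
  moreover have "w ((u i)\<^sup>2) * (v i - u i)\<^sup>2
      = 2 * (w ((u i)\<^sup>2) * v i * (v i - u i)) - w ((u i)\<^sup>2) * ((v i)\<^sup>2 - (u i)\<^sup>2)" for i
    by (simp add: power2_eq_square algebra_simps)
  ultimately have "w ((u i)\<^sup>2) * (v i - u i)\<^sup>2
      \<le> 2 * (w ((u i)\<^sup>2) * v i * (v i - u i)) + f ((u i)\<^sup>2) - f ((v i)\<^sup>2)" for i
    by (smt (verit))
  then have "(\<Sum>i\<in>UNIV. w ((u i)\<^sup>2) * (v i - u i)\<^sup>2)
      \<le> (\<Sum>i\<in>UNIV. 2 * (w ((u i)\<^sup>2) * v i * (v i - u i)) + f ((u i)\<^sup>2) - f ((v i)\<^sup>2))"
    by (rule sum_mono)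
  then have "(\<Sum>i\<in>UNIV. w ((u i)\<^sup>2) * (v i - u i)\<^sup>2)
      \<le> - (e \<bullet> (A *v d)) + (\<Sum>i\<in>UNIV. f ((u i)\<^sup>2)) - (\<Sum>i\<in>UNIV. f ((v i)\<^sup>2))"
    unfolding test by (simp add: sum.distrib sum_subtractf)
  then show ?thesis
    unfolding decrement_def objective_def quad
    by (simp add: Ld add_divide_distrib diff_divide_distrib flip: d_def u_def v_def e_def)
qed

section \<open>Bounds on the iterates and on the steps\<close>

lemma objective_le_initial: "objective (x k) \<le> objective (x 0)"
proof (induction k)
  case (Suc k)
  then show ?case using decrement_le[of k] decrement_nonneg[of k] by linarith
qed simp

text \<open>All iterates lie in the sublevel set of the initial objective. All terms of the
  objective are nonnegative, so each of them is bounded by \<open>C\<close>; the residual bounds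
  \<open>A *v x k\<close>, and under coercivity the penalty terms bound the components of
  \<open>\<Lambda> *v x k\<close>.\<close>

lemma iterates_bounded: "bounded (range x)"
proof -
  define C where "C = objective (x 0)"
  have pen: "0 \<le> f (((\<Lambda> *v z) $ i)\<^sup>2)" for z i by (simp add: f_nonneg)
  have AB: "norm (A *v x k) \<le> sqrt (2 * C) + norm b" for k
  proof -
    have "(norm (A *v x k - b))\<^sup>2 \<le> 2 * C"
      using objective_le_initial[of k] sum_nonneg[of UNIV "\<lambda>i. f (((\<Lambda> *v x k) $ i)\<^sup>2)"] pen
      by (simp add: objective_def C_def)
    then have "norm (A *v x k - b) \<le> sqrt (2 * C)" by (simp add: real_le_rsqrt)
    then show ?thesis using norm_triangle_ineq2[of "A *v x k" b] by linarith
  qed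
  have "\<exists>B. \<forall>k. norm (x k) \<le> B"
    using coercive
  proof (elim disjE conjE)
    assume "inj ((*v) A)"
    then obtain c where c: "c > 0" "\<And>z. c * norm z \<le> norm (A *v z)"
      using linear_inj_bounded_below_pos[of "(*v) A"] by auto
    have "norm (x k) \<le> (sqrt (2 * C) + norm b) / c" for k
      using order_trans[OF c(2) AB] c(1) by (simp add: pos_le_divide_eq mult.commute)
    then show ?thesis by blast
  next
    assume inj: "inj (\<lambda>z. (A *v z, \<Lambda> *v z))" and coer: "\<forall>C. \<exists>R. \<forall>y. f (y\<^sup>2) \<le> C \<longrightarrow> \<bar>y\<bar> \<le> R"
    obtain c where c: "c > 0" "\<And>z. c * norm z \<le> norm (A *v z, \<Lambda> *v z)"
      using linear_inj_bounded_below_pos[OF linear_matrix_vector_pair inj] by auto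
    obtain R where R: "\<And>y. f (y\<^sup>2) \<le> C \<Longrightarrow> \<bar>y\<bar> \<le> R" using coer by blast
    have "\<bar>(\<Lambda> *v x k) $ i\<bar> \<le> R" for k i
    proof (rule R)
      have "f (((\<Lambda> *v x k) $ i)\<^sup>2) \<le> (\<Sum>i\<in>UNIV. f (((\<Lambda> *v x k) $ i)\<^sup>2))"
        using pen by (intro member_le_sum) auto
      also have "\<dots> \<le> objective (x k)" by (simp add: objective_def)
      finally show "f (((\<Lambda> *v x k) $ i)\<^sup>2) \<le> C"
        using objective_le_initial[of k] by (simp add: C_def)
    qed
    then have LB: "norm (\<Lambda> *v x k) \<le> (\<Sum>i\<in>(UNIV::'r set). R)" for k
      by (intro order_trans[OF norm_le_l1_cart] sum_mono)
    have "norm (x k) \<le> (sqrt (2 * C) + norm b + (\<Sum>i\<in>(UNIV::'r set). R)) / c" for k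
    proof -
      have "c * norm (x k) \<le> sqrt (2 * C) + norm b + (\<Sum>i\<in>(UNIV::'r set). R)"
        using c(2)[of "x k"] norm_Pair_le[of "A *v x k" "\<Lambda> *v x k"] AB[of k] LB[of k] by linarith
      then show ?thesis using c(1) by (simp add: pos_le_divide_eq mult.commute)
    qed
    then show ?thesis by blast
  qed
  then show ?thesis by (auto simp: bounded_iff)
qed

lemma step_le_decrement:
  obtains K where "\<And>k. (norm (x (Suc k) - x k))\<^sup>2 \<le> K * decrement k"
proof -
  define d where "d k = x (Suc k) - x k" for k
  have wpart: "0 \<le> (\<Sum>i\<in>UNIV. w (((\<Lambda> *v x k) $ i)\<^sup>2) * ((\<Lambda> *v d k) $ i)\<^sup>2)" for k
    by (intro sum_nonneg mult_nonneg_nonneg w_nonneg) auto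
  have Apart: "(norm (A *v d k))\<^sup>2 \<le> 2 * decrement k" for k
    using wpart[of k] by (simp add: decrement_def d_def)
  have "\<exists>K. \<forall>k. (norm (d k))\<^sup>2 \<le> K * decrement k"
    using coercive
  proof (elim disjE conjE)
    assume "inj ((*v) A)"
    then obtain c where c: "c > 0" "\<And>z. c * norm z \<le> norm (A *v z)"
      using linear_inj_bounded_below_pos[of "(*v) A"] by auto
    have "(norm (d k))\<^sup>2 \<le> 2 / c\<^sup>2 * decrement k" for k
    proof -
      have "c\<^sup>2 * (norm (d k))\<^sup>2 \<le> (norm (A *v d k))\<^sup>2"
        using power_mono[OF c(2), of "d k" 2] c(1) by (simp add: power_mult_distrib)
      then have "c\<^sup>2 * (norm (d k))\<^sup>2 \<le> 2 * decrement k" using Apart[of k] by linarith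
      then show ?thesis using c(1) by (simp add: pos_le_divide_eq mult.commute)
    qed
    then show ?thesis by blast
  next
    assume inj: "inj (\<lambda>z. (A *v z, \<Lambda> *v z))" and wpos: "\<forall>t. 0 < w t"
    obtain c where c: "c > 0" "\<And>z. c * norm z \<le> norm (A *v z, \<Lambda> *v z)"
      using linear_inj_bounded_below_pos[OF linear_matrix_vector_pair inj] by auto
    have "bounded (range (\<lambda>k. \<Lambda> *v x k))"
      using bounded_linear_image[OF iterates_bounded, of "(*v) \<Lambda>"]
      by (simp add: matrix_vector_mul_bounded_linear image_image)
    then obtain R where R: "\<And>k. norm (\<Lambda> *v x k) \<le> R" by (auto simp: bounded_iff)
    \<comment> \<open>As \<open>w\<close> is nonincreasing, its value at the largest argument that
      can occur bounds all weights from below.\<close>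
    define \<omega> where "\<omega> = w (R\<^sup>2)"
    have \<omega>: "\<omega> > 0" using wpos by (simp add: \<omega>_def)
    have "\<omega> \<le> w (((\<Lambda> *v x k) $ i)\<^sup>2)" for k i
    proof -
      have "((\<Lambda> *v x k) $ i)\<^sup>2 \<le> R\<^sup>2"
        using order_trans[OF component_le_norm_cart R[of k], of i] by (metis abs_ge_zero power2_abs power_mono)
      then show ?thesis using w_antimono by (simp add: \<omega>_def antimono_def)
    qed
    then have "\<omega> * (norm (\<Lambda> *v d k))\<^sup>2 \<le> (\<Sum>i\<in>UNIV. w (((\<Lambda> *v x k) $ i)\<^sup>2) * ((\<Lambda> *v d k) $ i)\<^sup>2)" for k
      unfolding power2_norm_eq_inner inner_vec_def sum_distrib_left inner_real_def
        power2_eq_square[symmetric]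
      by (intro sum_mono mult_right_mono) auto
    then have "\<omega> * (norm (\<Lambda> *v d k))\<^sup>2 \<le> decrement k" for k
      by (simp add: decrement_def d_def add_increasing)
    then have Lpart: "(norm (\<Lambda> *v d k))\<^sup>2 \<le> 1 / \<omega> * decrement k" for k
      using \<omega> by (simp add: pos_le_divide_eq mult.commute)
    have "(norm (d k))\<^sup>2 \<le> (2 + 1 / \<omega>) / c\<^sup>2 * decrement k" for k
    proof -
      have "c\<^sup>2 * (norm (d k))\<^sup>2 \<le> (norm (A *v d k))\<^sup>2 + (norm (\<Lambda> *v d k))\<^sup>2"
        using power_mono[OF c(2), of "d k" 2] c(1) by (simp add: power_mult_distrib norm_Pair)
      then have "c\<^sup>2 * (norm (d k))\<^sup>2 \<le> (2 + 1 / \<omega>) * decrement k"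
        using Apart[of k] Lpart[of k] by (simp add: distrib_right)
      then show ?thesis using c(1) by (simp add: pos_le_divide_eq mult.commute)
    qed
    then show ?thesis by blast
  qed
  then show thesis using that by (auto simp: d_def)
qed

text \<open>The decrement lies between zero and the drop of the objective, so it vanishes, and with
  it the step.\<close>

lemma stationary_if_no_decrease:
  assumes "objective (x k) \<le> objective (x (Suc k))"
  shows "x (Suc k) = x k"
proof -
  obtain K where "(norm (x (Suc k) - x k))\<^sup>2 \<le> K * decrement k" using step_le_decrement by blast
  moreover have "decrement k = 0" using decrement_le[of k] decrement_nonneg[of k] assms by linarith
  ultimately show ?thesis by simp
qed

section \<open>Cluster points of the iterates\<close>

lemma step_tendsto_0: "(\<lambda>k. x (Suc k) - x k) \<longlonglongrightarrow> 0"
proof -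
  obtain K where K: "\<And>k. (norm (x (Suc k) - x k))\<^sup>2 \<le> K * decrement k" using step_le_decrement by blast
  have "decrement \<longlonglongrightarrow> 0"
    using decrements_tendsto_0[of "\<lambda>k. objective (x k)"] objective_nonneg decrement_nonneg decrement_le
    by blast
  then have "(\<lambda>k. K * decrement k) \<longlonglongrightarrow> 0" by (rule tendsto_mult_right_zero)
  then have "(\<lambda>k. (norm (x (Suc k) - x k))\<^sup>2) \<longlonglongrightarrow> 0"
    by (rule tendsto_sandwich[OF _ _ tendsto_const, rotated 2]) (use K in auto)
  then show ?thesis by (simp add: tendsto_norm_zero_iff)
qed

lemma cluster_point_stationary:
  assumes "cluster_point x l"
  shows "transpose A *v (A *v l - b)
     + 2 *\<^sub>R (transpose \<Lambda> *v (\<chi> i. w (((\<Lambda> *v l) $ i)\<^sup>2) * (\<Lambda> *v l) $ i)) = 0"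
proof -
  obtain s where s: "strict_mono s" "(\<lambda>k. x (s k)) \<longlonglongrightarrow> l"
    using assms by (auto simp: cluster_point_def o_def)
  \<comment> \<open>Vanishing steps give the shifted subsequence the same limit, so the old weights
    and the new iterate meet at \<open>l\<close>.\<close>
  have "(\<lambda>k. x (s k) + (x (Suc (s k)) - x (s k))) \<longlonglongrightarrow> l + 0"
    using LIMSEQ_subseq_LIMSEQ[OF step_tendsto_0 s(1)] by (intro tendsto_add s(2)) (simp add: o_def)
  then have s': "(\<lambda>k. x (Suc (s k))) \<longlonglongrightarrow> l" by simp
  have lin: "(\<lambda>k. M *v g k) \<longlonglongrightarrow> M *v h" if "g \<longlonglongrightarrow> h" for M :: "real^'c^'d" and g h
    by (rule bounded_linear.tendsto[OF matrix_vector_mul_bounded_linear that])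
  have "(\<lambda>k. w (((\<Lambda> *v x (s k)) $ i)\<^sup>2) * (\<Lambda> *v x (Suc (s k))) $ i)
      \<longlonglongrightarrow> w (((\<Lambda> *v l) $ i)\<^sup>2) * (\<Lambda> *v l) $ i" for i
  proof (rule tendsto_mult)
    show "(\<lambda>k. w (((\<Lambda> *v x (s k)) $ i)\<^sup>2)) \<longlonglongrightarrow> w (((\<Lambda> *v l) $ i)\<^sup>2)"
      by (rule isCont_tendsto_compose[OF concave_on_deriv_continuous[OF f_concave f_deriv]])
         (rule tendsto_power[OF tendsto_vec_nth[OF lin[OF s(2)]]])
    show "(\<lambda>k. (\<Lambda> *v x (Suc (s k))) $ i) \<longlonglongrightarrow> (\<Lambda> *v l) $ i"
      by (rule tendsto_vec_nth[OF lin[OF s']])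
  qed
  then have "(\<lambda>k. \<chi> i. w (((\<Lambda> *v x (s k)) $ i)\<^sup>2) * (\<Lambda> *v x (Suc (s k))) $ i)
      \<longlonglongrightarrow> (\<chi> i. w (((\<Lambda> *v l) $ i)\<^sup>2) * (\<Lambda> *v l) $ i)"
    by (intro vec_tendstoI) simp
  then have "(\<lambda>k. transpose A *v (A *v x (Suc (s k)) - b)
     + 2 *\<^sub>R (transpose \<Lambda> *v (\<chi> i. w (((\<Lambda> *v x (s k)) $ i)\<^sup>2) * (\<Lambda> *v x (Suc (s k))) $ i)))
    \<longlonglongrightarrow> transpose A *v (A *v l - b)
     + 2 *\<^sub>R (transpose \<Lambda> *v (\<chi> i. w (((\<Lambda> *v l) $ i)\<^sup>2) * (\<Lambda> *v l) $ i))"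
    by (rule tendsto_add[OF lin[OF tendsto_diff[OF lin[OF s'] tendsto_const]]
          tendsto_scaleR[OF tendsto_const lin]])
  \<comment> \<open>By \<open>iter\<close> the convergent sequence is constantly zero, hence so is
    its limit.\<close>
  then show ?thesis
    unfolding iter by (simp add: LIMSEQ_const_iff del: transpose_matrix_vector)
qed

lemma cluster_point_exists: "\<exists>l. cluster_point x l"
  using bounded_imp_convergent_subsequence[OF iterates_bounded] by (auto simp: cluster_point_def)

end

section \<open>The regularized penalty\<close>

context
  fixes \<phi> :: "real \<Rightarrow> real" and \<epsilon> :: real
  assumes nonneg: "\<forall>t. \<phi> t \<ge> 0" and nontrivial: "\<exists>t. \<phi> t \<noteq> 0"
    and H: "assumption_H \<phi>" and eps: "\<epsilon> > 0"
begin

text \<open>The derivative of \<open>Psi \<phi> \<epsilon>\<close> on the whole line, where the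
  affine branch continues to negative arguments.\<close>

definition weight :: "real \<Rightarrow> real" where
  "weight t = (if t \<le> \<epsilon>\<^sup>2 then deriv \<phi> \<epsilon> / (2 * \<epsilon>) else deriv \<phi> (sqrt t) / (2 * sqrt t))"

lemma phi_differentiable: "t > 0 \<Longrightarrow> \<phi> differentiable (at t)"
  using H by (simp add: assumption_H_def)

lemma phi_deriv: "t > 0 \<Longrightarrow> (\<phi> has_real_derivative deriv \<phi> t) (at t)"
  by (simp add: phi_differentiable DERIV_deriv_iff_real_differentiable)

lemma phi_below_tangent: "t > 0 \<Longrightarrow> u \<ge> 0 \<Longrightarrow> \<phi> u \<le> \<phi> t + deriv \<phi> t * (u - t)"
  using concave_on_below_tangent[OF _ _ _ phi_deriv, of "{0..}" t u] H
  by (simp add: assumption_H_def)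

lemma phi_mono: "0 \<le> s \<Longrightarrow> s \<le> t \<Longrightarrow> \<phi> s \<le> \<phi> t"
  using H by (auto simp: assumption_H_def mono_on_def)

lemma deriv_phi_nonneg:
  assumes "t > 0" shows "0 \<le> deriv \<phi> t"
proof -
  \<comment> \<open>The tangent at \<open>t\<close> is compared with monotonicity at the point
    \<open>2 * t\<close>.\<close>
  have "\<phi> (2 * t) \<le> \<phi> t + deriv \<phi> t * t" "\<phi> t \<le> \<phi> (2 * t)"
    using phi_below_tangent[of t "2 * t"] phi_mono[of t "2 * t"] assms by auto
  then have "0 \<le> deriv \<phi> t * t" by linarith
  then show ?thesis using assms by (simp add: zero_le_mult_iff)
qed

text \<open>Ensures \<open>\<phi> \<epsilon> \<noteq> 0\<close>, by which \<open>Psi\<close>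
  divides. If \<open>\<phi> t = 0\<close>, the tangent at \<open>t\<close>, evaluated at 0, forces
  slope zero; then the tangent is the zero line and \<open>\<phi>\<close> vanishes on the half-line,
  hence by evenness everywhere.\<close>

lemma phi_pos:
  assumes "t > 0" shows "0 < \<phi> t"
proof (rule ccontr)
  assume "\<not> 0 < \<phi> t"
  then have t: "\<phi> t = 0" using nonneg by (metis order_le_less)
  obtain s0 where "\<phi> s0 \<noteq> 0" using nontrivial by blast
  then have "\<phi> \<bar>s0\<bar> \<noteq> 0" using H by (auto simp: assumption_H_def abs_if)
  then obtain s where s: "s \<ge> 0" "\<phi> s > 0" using nonneg by (metis abs_ge_zero order_le_less)
  have "\<phi> 0 = 0" using H by (simp add: assumption_H_def)
  then have "deriv \<phi> t * t \<le> 0" using phi_below_tangent[of t 0] t assms by simp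
  then have "deriv \<phi> t = 0" using deriv_phi_nonneg[of t] assms by (smt (verit) mult_pos_pos)
  then show False using phi_below_tangent[of t s] s assms t by simp
qed

lemma deriv_phi_antimono: "0 < s \<Longrightarrow> s \<le> t \<Longrightarrow> deriv \<phi> t \<le> deriv \<phi> s"
  using concave_on_deriv_antimono[OF _ _ _ _ phi_deriv phi_deriv, of "{0..}" s t] H
  by (simp add: assumption_H_def)

lemma dPsi_eq_weight: "t \<ge> 0 \<Longrightarrow> dPsi \<phi> \<epsilon> t = weight t"
  unfolding weight_def using phi_pos[OF eps] by (intro dPsi_eq(2) eps phi_differentiable) simp_all

lemma Psi_deriv: "(Psi \<phi> \<epsilon> has_real_derivative weight t) (at t)"
proof (cases "t > 0")
  case True
  have "(Psi \<phi> \<epsilon> has_real_derivative weight t) (at t within {0..})"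
    unfolding weight_def has_real_derivative_iff_has_vector_derivative
    using phi_pos[OF eps] True by (intro dPsi_eq(1) eps phi_differentiable) simp_all
  moreover have "at t within {0..} = at t" by (rule at_within_interior) (use True in simp)
  ultimately show ?thesis by simp
next
  case False
  \<comment> \<open>This case includes \<open>t = 0\<close>, where \<open>dPsi_eq\<close> gives only
    a one-sided derivative; the affine formula holds on an open half-line around \<open>t\<close>
    and gives the two-sided one.\<close>
  have "t < \<epsilon>\<^sup>2" using False eps by (smt (verit) zero_less_power)
  show ?thesis
  proof (rule has_field_derivative_transform_within_open[where S = "{..<\<epsilon>\<^sup>2}"])
    show "((\<lambda>t. deriv \<phi> \<epsilon> / (2 * \<epsilon>) * t + (1 - deriv \<phi> \<epsilon> * \<epsilon> / (2 * \<phi> \<epsilon>)) * \<phi> \<epsilon>)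
        has_real_derivative weight t) (at t)"
      using \<open>t < \<epsilon>\<^sup>2\<close> eps by (auto intro!: derivative_eq_intros simp: weight_def)
  qed (use \<open>t < \<epsilon>\<^sup>2\<close> in \<open>auto simp: Psi_def\<close>)
qed

text \<open>Lets the affine branch be treated as the value of the other branch at \<open>\<epsilon>\<close>.\<close>

lemma weight_alt:
  obtains r where "r = max \<epsilon> (sqrt t)" "r > 0" "weight t = deriv \<phi> r / (2 * r)"
proof (rule that[OF refl])
  have "sqrt t \<le> \<epsilon> \<longleftrightarrow> t \<le> \<epsilon>\<^sup>2" using eps by (metis order_less_imp_le real_le_lsqrt sqrt_le_D)
  then show "weight t = deriv \<phi> (max \<epsilon> (sqrt t)) / (2 * max \<epsilon> (sqrt t))"
    by (auto simp: weight_def max_def)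
qed (use eps in auto)

lemma weight_nonneg: "0 \<le> weight t"
  using weight_alt[of t] deriv_phi_nonneg by (metis divide_nonneg_pos mult_pos_pos zero_less_numeral)

lemma weight_antimono: "antimono weight"
proof (rule antimonoI)
  fix s t :: real assume "s \<le> t"
  obtain r where r: "r = max \<epsilon> (sqrt s)" "r > 0" "weight s = deriv \<phi> r / (2 * r)"
    by (rule weight_alt)
  obtain q where q: "q = max \<epsilon> (sqrt t)" "q > 0" "weight t = deriv \<phi> q / (2 * q)"
    by (rule weight_alt)
  \<comment> \<open>\<open>sqrt\<close> is monotone on all of the reals, with negative values at
    negative arguments, so signs need no case split.\<close>
  have "sqrt s \<le> sqrt t" using \<open>s \<le> t\<close> by simp
  then have "r \<le> q" unfolding r(1) q(1) by linarith
  then show "weight t \<le> weight s"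
    unfolding r(3) q(3) using r(2) deriv_phi_antimono[of r q] deriv_phi_nonneg[of q] q(2)
    by (intro frac_le) auto
qed

text \<open>The constant term of the affine branch is nonnegative because the tangent at
  \<open>\<epsilon>\<close>, evaluated at 0, gives
  \<open>deriv \<phi> \<epsilon> * \<epsilon> \<le> \<phi> \<epsilon>\<close>.\<close>

lemma Psi_nonneg:
  assumes "0 \<le> t" shows "0 \<le> Psi \<phi> \<epsilon> t"
proof (cases "t \<le> \<epsilon>\<^sup>2")
  case True
  have "\<phi> 0 = 0" using H by (simp add: assumption_H_def)
  then have "deriv \<phi> \<epsilon> * \<epsilon> \<le> \<phi> \<epsilon>" using phi_below_tangent[of \<epsilon> 0] eps by simp
  then have "0 \<le> 1 - deriv \<phi> \<epsilon> * \<epsilon> / (2 * \<phi> \<epsilon>)"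
    using phi_pos[OF eps] by (simp add: divide_le_eq)
  then show ?thesis
    using True assms eps nonneg deriv_phi_nonneg[OF eps] by (simp add: Psi_def)
qed (use nonneg in \<open>simp add: Psi_def\<close>)

section \<open>Homogeneous penalties\<close>

context
  fixes \<gamma> :: real
  assumes \<gamma>: "\<gamma> > 0" and hom: "\<And>t a. a > 0 \<Longrightarrow> \<phi> (a * t) = a powr \<gamma> * \<phi> t"
begin

text \<open>Homogeneity makes \<open>\<phi>\<close> strictly larger at \<open>2 * r\<close> than at
  \<open>r\<close>, so the tangent at \<open>r\<close> must have positive slope.\<close>

lemma homogeneous_weight_pos: "0 < weight t"
proof -
  obtain r where r: "r > 0" "weight t = deriv \<phi> r / (2 * r)" by (rule weight_alt)
  have "\<phi> r < 2 powr \<gamma> * \<phi> r" using phi_pos[OF r(1)] \<gamma> by simp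
  also have "\<dots> = \<phi> (2 * r)" by (simp add: hom)
  also have "\<dots> \<le> \<phi> r + deriv \<phi> r * r" using phi_below_tangent[of r "2 * r"] r(1) by simp
  finally have "0 < deriv \<phi> r" using r(1) by (simp add: zero_less_mult_iff)
  then show ?thesis using r by simp
qed

lemma homogeneous_Psi_coercive: "\<exists>R. \<forall>y. Psi \<phi> \<epsilon> (y\<^sup>2) \<le> C \<longrightarrow> \<bar>y\<bar> \<le> R"
proof (intro exI allI impI)
  fix y assume y: "Psi \<phi> \<epsilon> (y\<^sup>2) \<le> C"
  \<comment> \<open>Beyond \<open>\<epsilon>\<close> the penalty is
    \<open>\<bar>y\<bar> powr \<gamma> * \<phi> 1\<close>; the second entry of the maximum solves
    for \<open>\<bar>y\<bar>\<close>.\<close>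
  show "\<bar>y\<bar> \<le> max \<epsilon> ((C / \<phi> 1) powr (1 / \<gamma>))"
  proof (cases "\<bar>y\<bar> \<le> \<epsilon>")
    case False
    then have "\<epsilon>\<^sup>2 < y\<^sup>2" using eps by (metis less_imp_le not_le power2_abs power_strict_mono pos2)
    then have "\<phi> \<bar>y\<bar> \<le> C" using y by (simp add: Psi_def)
    moreover have "\<phi> \<bar>y\<bar> = \<bar>y\<bar> powr \<gamma> * \<phi> 1" using hom[of "\<bar>y\<bar>" 1] False eps by simp
    ultimately have "\<bar>y\<bar> powr \<gamma> \<le> C / \<phi> 1" using phi_pos[of 1] by (simp add: pos_le_divide_eq)
    then have "(\<bar>y\<bar> powr \<gamma>) powr (1 / \<gamma>) \<le> (C / \<phi> 1) powr (1 / \<gamma>)"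
      using \<gamma> by (intro powr_mono2) auto
    then show ?thesis using \<gamma> by (simp add: powr_powr)
  qed simp
qed

end

end

section \<open>Application to the regularized functional\<close>

theorem theorem2p3:
  fixes A :: "real^'n^'m" and \<Lambda> :: "real^'n^'r" and b :: "real^'m"
    and \<phi> :: "real \<Rightarrow> real" and \<epsilon> :: real and x :: "nat \<Rightarrow> real^'n"
  assumes "\<forall>t. \<phi> t \<ge> 0" and "\<exists>t. \<phi> t \<noteq> 0"
    and "assumption_H \<phi>"
    and "assumption_a \<phi> A \<or> assumption_b \<phi> A \<Lambda>"
    and "\<epsilon> > 0"
    and "iterates \<phi> A \<Lambda> b \<epsilon> x"
  shows "((\<forall>k. J \<phi> A \<Lambda> b \<epsilon> (x (Suc k)) < J \<phi> A \<Lambda> b \<epsilon> (x k)) \<or>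
          (\<exists>k. x k = x (Suc k) \<and> optimality_condition \<phi> A \<Lambda> b \<epsilon> (x k)))
       \<and> (\<exists>l. cluster_point x l)
       \<and> (\<forall>l. cluster_point x l \<longrightarrow> optimality_condition \<phi> A \<Lambda> b \<epsilon> l)"
proof -
  note std = assms(1-3,5)
  have mult: "dPsi_mult \<phi> \<epsilon> y z = (\<chi> i. weight \<phi> \<epsilon> ((y $ i)\<^sup>2) * z $ i)" for y z :: "real^'r"
    by (simp add: dPsi_mult_def dPsi_eq_weight[OF std])
  have normal: "(transpose A ** A) *v z + v = transpose A *v b \<longleftrightarrow> transpose A *v (A *v z - b) + v = 0"
    for z v
    by (auto simp: matrix_vector_mult_diff_distrib algebra_simps
        simp flip: matrix_vector_mul_assoc simp del: transpose_matrix_vector)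
  have "inj (\<lambda>z. (A *v z, \<Lambda> *v z))" if "ker A \<inter> ker \<Lambda> = {0}"
  proof (rule injI)
    fix u v assume "(A *v u, \<Lambda> *v u) = (A *v v, \<Lambda> *v v)"
    then have "u - v \<in> ker A \<inter> ker \<Lambda>" by (simp add: ker_def matrix_vector_mult_diff_distrib)
    then show "u = v" using that by simp
  qed
  \<comment> \<open>Full column rank is injectivity of \<open>A\<close>, which settles (a); in (b)
    the kernel condition and homogeneity give the other disjunct.\<close>
  then have coercive: "inj ((*v) A) \<or> inj (\<lambda>z. (A *v z, \<Lambda> *v z)) \<and> (\<forall>t. 0 < weight \<phi> \<epsilon> t) \<and>
      (\<forall>C. \<exists>R. \<forall>y. Psi \<phi> \<epsilon> (y\<^sup>2) \<le> C \<longrightarrow> \<bar>y\<bar> \<le> R)"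
    using assms(4) homogeneous_weight_pos[OF std] homogeneous_Psi_coercive[OF std]
    unfolding assumption_a_def assumption_b_def full_rank_injective by blast
  interpret reweighted_least_squares A \<Lambda> b "Psi \<phi> \<epsilon>" "weight \<phi> \<epsilon>" x
    using assms(6) Psi_deriv[OF std] weight_antimono[OF std] weight_nonneg[OF std] Psi_nonneg[OF std]
      coercive
    by unfold_locales (auto simp: iterates_def normal mult simp del: transpose_matrix_vector)
  have J: "J \<phi> A \<Lambda> b \<epsilon> = objective"
    by (rule ext) (simp add: J_def objective_def)
  have opt: "optimality_condition \<phi> A \<Lambda> b \<epsilon> z \<longleftrightarrow> transpose A *v (A *v z - b)
     + 2 *\<^sub>R (transpose \<Lambda> *v (\<chi> i. weight \<phi> \<epsilon> (((\<Lambda> *v z) $ i)\<^sup>2) * (\<Lambda> *v z) $ i)) = 0" for z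
    by (simp add: optimality_condition_def normal mult del: transpose_matrix_vector)
  \<comment> \<open>Once the step is zero, the iteration equation at \<open>k\<close> is itself the
    optimality condition at \<open>x k\<close>.\<close>
  have "x k = x (Suc k) \<and> optimality_condition \<phi> A \<Lambda> b \<epsilon> (x k)"
    if "\<not> objective (x (Suc k)) < objective (x k)" for k
    using stationary_if_no_decrease[of k] that iter[of k] unfolding opt by simp
  then show ?thesis
    using cluster_point_exists cluster_point_stationary unfolding J opt by blast
qed

end
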